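(* Let $E$ be a strict $(LF)$-space. Then the weak$^*$-dual $(E^*,\sigma(E^*,E))$ of $E$ contains a basic sequence. In fact, $(E^*,\sigma(E^*,E))$ contains a complemented copy of $\mathbb{R}^{\mathbb{N}}$ (with the product topology).
   Context: All vector spaces are real. A Fréchet space is a metrizable and complete locally convex space. Let $E$ be a vector space and $(E_n,\tau_n)_{n\in\mathbb{N}}$ a strictly increasing sequence of vector subspaces of $E$ covering $E$, each $(E_n,\tau_n)$ being a Fréchet space, such that $\tau_{n+1}|E_n\le\tau_n$ for each $n$. Let $\tau$ be the finest locally convex topology on $E$ such that $\tau|E_n\le\tau_n$ for each $n$. Then $(E,\tau)$ is called an $(LF)$-space. If moreover $\tau_{n+1}|E_n=\tau_n$ for each $n\in\mathbb{N}$, then $(E,\tau)$ is the strict inductive limit of $(E_n,\tau_n)$ and is called a strict $(LF)$-space. $E^*$ is the topological dual of $E$. A locally convex space $F$ contains a complemented copy of $G$ if there is a linear subspace of $F$ which is linearly homeomorphic to $G$ and is the range of a continuous linear projection on $F$. A sequence $(e_n)_{n\in\mathbb{N}}$ in a locally convex space $F$ is a Schauder basis of $F$ if every $x\in F$ has a unique representation $x=\sum_{n=1}^\infty b_ne_n$ (convergence in the topology of $F$) and all coefficient functionals $x\mapsto b_n$ are continuous on $F$. A sequence is basic if it is a Schauder basis of its closed linear span. *)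

theory Defs
  imports "HOL-Analysis.Analysis" "HOL-Library.Function_Algebras"
begin

instantiation "fun" :: (type, real_vector) real_vector
begin

definition scaleR_fun_def: "c *\<^sub>R f = (\<lambda>x. c *\<^sub>R f x)"

instance
  by standard (simp_all add: scaleR_fun_def fun_eq_iff scaleR_add_right scaleR_add_left)

end

lemma scaleR_fun_apply [simp]: "(c *\<^sub>R f) x = c *\<^sub>R f x"
  by (simp add: scaleR_fun_def)

text \<open>
  A topological vector space is given by its topology \<open>T\<close> alone: the underlying vector space
  is \<open>topspace T\<close>, a linear subspace of the ambient type. Thus the steps of an inductive
  sequence, a dual space inside \<open>'a \<Rightarrow> real\<close>, and a closed linear span are all treated
  uniformly. Hausdorffness is not part of the definition; it follows from metrizability
  in the case of Frechet spaces.
\<close>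

definition top_vector_space :: "'a::real_vector topology \<Rightarrow> bool" where
  "top_vector_space T \<longleftrightarrow>
     subspace (topspace T) \<and>
     continuous_map (prod_topology T T) T (\<lambda>(x, y). x + y) \<and>
     continuous_map (prod_topology euclideanreal T) T (\<lambda>(c, x). c *\<^sub>R x)"

definition locally_convex_space :: "'a::real_vector topology \<Rightarrow> bool" where
  "locally_convex_space T \<longleftrightarrow>
     top_vector_space T \<and>
     (\<forall>U. openin T U \<and> 0 \<in> U \<longrightarrow> (\<exists>C. convex C \<and> C \<subseteq> U \<and> 0 \<in> T interior_of C))"

definition Cauchy_filter_in :: "'a::real_vector topology \<Rightarrow> 'a filter \<Rightarrow> bool" where
  "Cauchy_filter_in T F \<longleftrightarrow>
     F \<noteq> bot \<and> eventually (\<lambda>x. x \<in> topspace T) F \<and>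
     (\<forall>U. openin T U \<and> 0 \<in> U \<longrightarrow> eventually (\<lambda>(x, y). x - y \<in> U) (F \<times>\<^sub>F F))"

definition complete_tvs :: "'a::real_vector topology \<Rightarrow> bool" where
  "complete_tvs T \<longleftrightarrow> (\<forall>F. Cauchy_filter_in T F \<longrightarrow> (\<exists>l. limitin T (\<lambda>x. x) l F))"

definition Frechet_space :: "'a::real_vector topology \<Rightarrow> bool" where
  "Frechet_space T \<longleftrightarrow> locally_convex_space T \<and> metrizable_space T \<and> complete_tvs T"

definition coarser_eq :: "'a topology \<Rightarrow> 'a topology \<Rightarrow> bool" where
  "coarser_eq S T \<longleftrightarrow> topspace S = topspace T \<and> (\<forall>U. openin S U \<longrightarrow> openin T U)"

definition LF_sequence :: "(nat \<Rightarrow> 'a::real_vector topology) \<Rightarrow> bool" where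
  "LF_sequence T \<longleftrightarrow>
     (\<forall>n. Frechet_space (T n)) \<and>
     (\<forall>n. topspace (T n) \<subset> topspace (T (Suc n))) \<and>
     (\<Union>n. topspace (T n)) = UNIV \<and>
     (\<forall>n. coarser_eq (subtopology (T (Suc n)) (topspace (T n))) (T n))"

definition compatible_lc_topology :: "(nat \<Rightarrow> 'a::real_vector topology) \<Rightarrow> 'a topology \<Rightarrow> bool" where
  "compatible_lc_topology T \<sigma> \<longleftrightarrow>
     locally_convex_space \<sigma> \<and> topspace \<sigma> = UNIV \<and>
     (\<forall>n. coarser_eq (subtopology \<sigma> (topspace (T n))) (T n))"

definition inductive_limit_topology :: "(nat \<Rightarrow> 'a::real_vector topology) \<Rightarrow> 'a topology \<Rightarrow> bool" where
  "inductive_limit_topology T \<tau> \<longleftrightarrow>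
     compatible_lc_topology T \<tau> \<and>
     (\<forall>\<sigma>. compatible_lc_topology T \<sigma> \<longrightarrow> coarser_eq \<sigma> \<tau>)"

definition LF_space :: "'a::real_vector topology \<Rightarrow> bool" where
  "LF_space \<tau> \<longleftrightarrow> (\<exists>T. LF_sequence T \<and> inductive_limit_topology T \<tau>)"

definition strict_LF_space :: "'a::real_vector topology \<Rightarrow> bool" where
  "strict_LF_space \<tau> \<longleftrightarrow>
     (\<exists>T. LF_sequence T \<and> inductive_limit_topology T \<tau> \<and>
          (\<forall>n. subtopology (T (Suc n)) (topspace (T n)) = T n))"

text \<open>The dual and its weak-star topology are meant for topologies on the whole type,
  i.e. \<open>topspace T = UNIV\<close>; elements of the dual are then honest linear functions.\<close>

definition continuous_dual :: "'a::real_vector topology \<Rightarrow> ('a \<Rightarrow> real) set" where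
  "continuous_dual T = {f. linear f \<and> continuous_map T euclideanreal f}"

definition weak_star :: "'a::real_vector topology \<Rightarrow> ('a \<Rightarrow> real) topology" where
  "weak_star T = subtopology (powertop_real UNIV) (continuous_dual T)"

definition linear_map_on :: "'a::real_vector set \<Rightarrow> ('a \<Rightarrow> 'b::real_vector) \<Rightarrow> bool" where
  "linear_map_on V f \<longleftrightarrow>
     (\<forall>x\<in>V. \<forall>y\<in>V. f (x + y) = f x + f y) \<and> (\<forall>c. \<forall>x\<in>V. f (c *\<^sub>R x) = c *\<^sub>R f x)"

definition linearly_homeomorphic :: "'a::real_vector topology \<Rightarrow> 'b::real_vector topology \<Rightarrow> bool" where
  "linearly_homeomorphic S T \<longleftrightarrow> (\<exists>h. homeomorphic_map S T h \<and> linear_map_on (topspace S) h)"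

definition continuous_projection :: "'a::real_vector topology \<Rightarrow> ('a \<Rightarrow> 'a) \<Rightarrow> bool" where
  "continuous_projection F P \<longleftrightarrow>
     continuous_map F F P \<and> linear_map_on (topspace F) P \<and> (\<forall>x\<in>topspace F. P (P x) = P x)"

definition contains_complemented_copy :: "'a::real_vector topology \<Rightarrow> 'b::real_vector topology \<Rightarrow> bool" where
  "contains_complemented_copy F G \<longleftrightarrow>
     (\<exists>V. subspace V \<and> V \<subseteq> topspace F \<and> linearly_homeomorphic (subtopology F V) G \<and>
          (\<exists>P. continuous_projection F P \<and> P ` topspace F = V))"

definition series_converges_to ::
    "'a::real_vector topology \<Rightarrow> (nat \<Rightarrow> 'a) \<Rightarrow> (nat \<Rightarrow> real) \<Rightarrow> 'a \<Rightarrow> bool" where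
  "series_converges_to F e b x \<longleftrightarrow> limitin F (\<lambda>N. \<Sum>n<N. b n *\<^sub>R e n) x sequentially"

definition schauder_coeff :: "'a::real_vector topology \<Rightarrow> (nat \<Rightarrow> 'a) \<Rightarrow> nat \<Rightarrow> 'a \<Rightarrow> real" where
  "schauder_coeff F e n x = (THE b. series_converges_to F e b x) n"

definition Schauder_basis :: "'a::real_vector topology \<Rightarrow> (nat \<Rightarrow> 'a) \<Rightarrow> bool" where
  "Schauder_basis F e \<longleftrightarrow>
     range e \<subseteq> topspace F \<and>
     (\<forall>x\<in>topspace F. \<exists>!b. series_converges_to F e b x) \<and>
     (\<forall>n. continuous_map F euclideanreal (schauder_coeff F e n))"

definition basic_sequence :: "'a::real_vector topology \<Rightarrow> (nat \<Rightarrow> 'a) \<Rightarrow> bool" where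
  "basic_sequence F e \<longleftrightarrow>
     range e \<subseteq> topspace F \<and>
     Schauder_basis (subtopology F (F closure_of span (range e))) e"

end

theory Submission
  imports Defs
begin

text \<open>
  Let \<open>T 0, T 1, \<dots>\<close> be the steps of the strict inductive sequence. Each step is complete, and by
  strictness it is a topological subspace of the next step, so it is closed there
  (\<open>complete_subspace_closedin\<close>). Choose a vector \<open>x n\<close> in step \<open>n + 1\<close> outside step \<open>n\<close>. By the
  Hahn-Banach theorem there is a continuous functional on step \<open>n + 1\<close> that vanishes on step \<open>n\<close>
  and takes the value \<open>1\<close> at \<open>x n\<close>; strictness again lets it be extended continuously from each step
  to the next, and a linear functional on the limit is continuous as soon as its restriction to
  every step is. The result is \<open>f n\<close> in the dual (\<open>exists_dual_vanishing_on_step\<close>). The matrix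
  \<open>f n (x m)\<close> is triangular with unit diagonal, so the vectors can be corrected to vectors \<open>y m\<close> with
  \<open>f n (y m) = \<delta>\<^sub>n\<^sub>m\<close> (\<open>exists_biorthogonal_vector\<close>).

  Every vector lies in some step, and hence is annihilated by all but finitely many \<open>f n\<close>. Therefore
  \<open>\<Sum>n. a n * f n v\<close> is a finite sum for each \<open>v\<close>, and for arbitrary real coefficients it defines a
  functional that is continuous on every step, i.e. an element of the dual. The two maps
  \<open>a \<mapsto> (\<Sum>n. a n * f n)\<close> and \<open>g \<mapsto> (\<lambda>n. g (y n))\<close> between the space of all real sequences and the dual are
  continuous for the topologies of pointwise convergence, because each coordinate of the image
  is a linear combination of finitely many coordinates of the argument, and the second is a left
  inverse of the first. So the range of the first is a complemented copy of the sequence space, and the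
  series above is the expansion of its elements with respect to the basic sequence \<open>f\<close>.
\<close>

section \<open>The Hahn-Banach theorem for convex sets and locally convex spaces\<close>

text \<open>
  The Hahn-Banach theorem is proved for functionals bounded by \<open>1\<close> on a convex set, without
  passing to its gauge. Partially defined functionals are represented by their graphs, i.e. by
  subspaces of the product with \<open>\<real>\<close>. To add the direction \<open>y\<close>, the value \<open>a\<close> at \<open>y\<close> must lie above all
  the numbers in \<open>L\<close> and below all those in \<open>U\<close>; that \<open>L\<close> lies below \<open>U\<close> is seen by taking a
  convex combination of two points of \<open>C\<close> that falls into the old domain.
  The two points of \<open>C\<close> on the line through \<open>y\<close> make \<open>L\<close> and \<open>U\<close> nonempty.
\<close>

lemma bounded_extension_one_step:
  fixes M :: "('a::real_vector \<times> real) set"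
  assumes M: "subspace M" and C: "convex C"
    and bound: "\<And>x r. (x, r) \<in> M \<Longrightarrow> x \<in> C \<Longrightarrow> r \<le> 1"
    and pos: "t0 > 0" "t0 *\<^sub>R y \<in> C" and neg: "s0 > 0" "s0 *\<^sub>R (- y) \<in> C"
  obtains a where "\<And>x r. (x, r) \<in> span (insert (y, a) M) \<Longrightarrow> x \<in> C \<Longrightarrow> r \<le> 1"
proof -
  define L where "L = {(r - 1) / s | r s w. s > 0 \<and> (w, r) \<in> M \<and> w - s *\<^sub>R y \<in> C}"
  define U where "U = {(1 - r) / t | r t w. t > 0 \<and> (w, r) \<in> M \<and> w + t *\<^sub>R y \<in> C}"
  have L_I: "(r - 1) / s \<in> L" if "s > 0" "(w, r) \<in> M" "w - s *\<^sub>R y \<in> C" for r s w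
    using that by (auto simp: L_def)
  have U_I: "(1 - r) / t \<in> U" if "t > 0" "(w, r) \<in> M" "w + t *\<^sub>R y \<in> C" for r t w
    using that by (auto simp: U_def)
  have zero: "(0, 0) \<in> M"
    using subspace_0[OF M] by (simp add: zero_prod_def)
  have LU: "l \<le> u" if l: "l \<in> L" and u: "u \<in> U" for l u
  proof -
    obtain r s w where 1: "l = (r - 1) / s" "s > 0" "(w, r) \<in> M" "w - s *\<^sub>R y \<in> C"
      using l by (auto simp: L_def)
    obtain r' t w' where 2: "u = (1 - r') / t" "t > 0" "(w', r') \<in> M" "w' + t *\<^sub>R y \<in> C"
      using u by (auto simp: U_def)
    \<comment> \<open>The weights make the multiples of \<open>y\<close> cancel.\<close>
    define p q where "p = t / (s + t)" and "q = s / (s + t)"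
    have pq: "p \<ge> 0" "q \<ge> 0" "p + q = 1" "p * s = q * t"
      using 1(2) 2(2) by (auto simp: p_def q_def add_divide_distrib [symmetric])
    have "p *\<^sub>R (w - s *\<^sub>R y) + q *\<^sub>R (w' + t *\<^sub>R y) \<in> C"
      using convexD[OF C 1(4) 2(4) pq(1-3)] .
    moreover have "p *\<^sub>R (w - s *\<^sub>R y) + q *\<^sub>R (w' + t *\<^sub>R y) = p *\<^sub>R w + q *\<^sub>R w'"
      by (simp add: scaleR_diff_right scaleR_add_right pq(4))
    moreover have "(p *\<^sub>R w + q *\<^sub>R w', p * r + q * r') \<in> M"
      using subspace_add[OF M subspace_scale[OF M 1(3), of p] subspace_scale[OF M 2(3), of q]]
      by simp
    ultimately have "p * r + q * r' \<le> 1"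
      using bound by metis
    then have "t * r + s * r' \<le> s + t"
      using 1(2) 2(2) by (simp add: p_def q_def divide_simps)
    then show "l \<le> u"
      using 1(2) 2(2) unfolding 1(1) 2(1) by (simp add: field_simps)
  qed
  have "- 1 / s0 \<in> L"
    using L_I[OF neg(1) zero] neg(2) by simp
  then have Lne: "L \<noteq> {}" by auto
  have u0: "1 / t0 \<in> U"
    using U_I[OF pos(1) zero] pos(2) by simp
  have bdd: "bdd_above L"
    using LU[OF _ u0] by (auto simp: bdd_above_def)
  have lower: "l \<le> Sup L" if "l \<in> L" for l
    using cSup_upper[OF that bdd] .
  have upper: "Sup L \<le> u" if "u \<in> U" for u
    using cSup_least[OF Lne] LU[OF _ that] by blast
  show thesis
  proof (rule that[of "Sup L"])
    fix x r assume "(x, r) \<in> span (insert (y, Sup L) M)" and xC: "x \<in> C"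
    then obtain k where "(x, r) - k *\<^sub>R (y, Sup L) \<in> span M"
      by (auto simp: span_breakdown_eq)
    then have k: "(x - k *\<^sub>R y, r - k * Sup L) \<in> M"
      by (simp add: span_eq_iff[THEN iffD2, OF M])
    consider "k = 0" | "k > 0" | "k < 0" by linarith
    then show "r \<le> 1"
    proof cases
      case 1
      then show ?thesis using k xC bound by simp
    next
      case 2
      then have "(1 - (r - k * Sup L)) / k \<in> U"
        using U_I[OF _ k] xC by simp
      from upper[OF this] 2 show ?thesis by (simp add: field_simps)
    next
      case 3
      then have "((r - k * Sup L) - 1) / (- k) \<in> L"
        using L_I[OF _ k, of "- k"] xC by simp
      from lower[OF this] 3 show ?thesis by (simp add: field_simps)
    qed
  qed
qed

lemma subspace_Union_chain:
  assumes "\<C> \<noteq> {}" "subset.chain \<A> \<C>" "\<And>G. G \<in> \<C> \<Longrightarrow> subspace G"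
  shows "subspace (\<Union>\<C>)"
proof (rule subspaceI)
  show "0 \<in> \<Union>\<C>" using assms subspace_0 by blast
next
  fix x y assume "x \<in> \<Union>\<C>" "y \<in> \<Union>\<C>"
  then obtain G H where GH: "G \<in> \<C>" "H \<in> \<C>" "x \<in> G" "y \<in> H" by auto
  then consider "G \<subseteq> H" | "H \<subseteq> G"
    using assms(2) by (auto simp: subset_chain_def)
  then show "x + y \<in> \<Union>\<C>"
    by cases (use GH assms(3) subspace_add in blast)+
next
  fix c x assume "x \<in> \<Union>\<C>"
  then show "c *\<^sub>R x \<in> \<Union>\<C>" using assms(3) subspace_scale by blast
qed

text \<open>
  Zorn's lemma is applied to graphs. A subspace that satisfies the bound is automatically the graph
  of a function: a nonzero vertical line over \<open>0 \<in> C\<close> would violate it.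
\<close>

lemma Hahn_Banach_convex:
  fixes G0 :: "('a::real_vector \<times> real) set"
  assumes V: "subspace V" and G0: "subspace G0" "fst ` G0 \<subseteq> V"
    and C: "convex C" and absorb: "\<And>v. v \<in> V \<Longrightarrow> \<exists>t>0. t *\<^sub>R v \<in> C"
    and bound: "\<And>x r. (x, r) \<in> G0 \<Longrightarrow> x \<in> C \<Longrightarrow> r \<le> 1"
  obtains F where "linear_map_on V F" "\<And>x. x \<in> V \<Longrightarrow> x \<in> C \<Longrightarrow> F x \<le> 1"
    "\<And>x r. (x, r) \<in> G0 \<Longrightarrow> F x = r"
proof -
  define \<A> where "\<A> = {G. subspace G \<and> G0 \<subseteq> G \<and> fst ` G \<subseteq> V \<and> (\<forall>x r. (x, r) \<in> G \<longrightarrow> x \<in> C \<longrightarrow> r \<le> 1)}"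
  have "G0 \<in> \<A>" using G0 bound by (auto simp: \<A>_def)
  moreover have "\<Union>\<C> \<in> \<A>" if ne: "\<C> \<noteq> {}" and ch: "subset.chain \<A> \<C>" for \<C>
  proof -
    have sub: "\<C> \<subseteq> \<A>" using ch by (auto simp: subset.chain_def)
    have "subspace (\<Union>\<C>)"
      using subspace_Union_chain[OF ne ch] sub by (auto simp: \<A>_def)
    then show ?thesis using sub ne unfolding \<A>_def by blast
  qed
  ultimately obtain M where MA: "M \<in> \<A>" and max: "\<And>X. X \<in> \<A> \<Longrightarrow> M \<subseteq> X \<Longrightarrow> X = M"
    using subset_Zorn_nonempty[of \<A>] by blast
  have M: "subspace M" "G0 \<subseteq> M" "fst ` M \<subseteq> V" and Mb: "\<And>x r. (x, r) \<in> M \<Longrightarrow> x \<in> C \<Longrightarrow> r \<le> 1"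
    using MA by (auto simp: \<A>_def)
  have dom: "\<exists>r. (y, r) \<in> M" if y: "y \<in> V" for y
  proof -
    obtain t0 s0 where ts: "t0 > 0" "t0 *\<^sub>R y \<in> C" "s0 > 0" "s0 *\<^sub>R (- y) \<in> C"
      using absorb[OF y] absorb[of "- y"] subspace_neg[OF V y] by auto
    obtain a where a: "\<And>x r. (x, r) \<in> span (insert (y, a) M) \<Longrightarrow> x \<in> C \<Longrightarrow> r \<le> 1"
      by (rule bounded_extension_one_step[OF M(1) C _ ts]) (use Mb in auto)
    have MS: "insert (y, a) M \<subseteq> span (insert (y, a) M)" by (rule span_superset)
    have "span (insert (y, a) M) \<subseteq> V \<times> UNIV"
      by (rule span_minimal) (use y M(3) V in \<open>auto simp: subspace_Times\<close>)
    then have "span (insert (y, a) M) \<in> \<A>"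
      using a MS M(2) by (auto simp: \<A>_def)
    then have "span (insert (y, a) M) = M" using max MS by blast
    then show ?thesis using MS by blast
  qed
  have zero_C: "0 \<in> C" using absorb[OF subspace_0[OF V]] by auto
  have vert: "r = 0" if "(0, r) \<in> M" for r
  proof (rule ccontr)
    assume "r \<noteq> 0"
    moreover have "(0, (2 / r) * r) \<in> M"
      using subspace_scale[OF M(1) that, of "2 / r"] by simp
    ultimately show False using Mb[OF _ zero_C] by fastforce
  qed
  have unique: "r = r'" if "(x, r) \<in> M" "(x, r') \<in> M" for x r r'
    using vert[of "r - r'"] subspace_diff[OF M(1) that] by simp
  define F where "F x = (THE r. (x, r) \<in> M)" for x
  have F_eq: "F x = r" if "(x, r) \<in> M" for x r
    unfolding F_def by (rule the_equality) (use that unique in auto)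
  have F_in: "(x, F x) \<in> M" if "x \<in> V" for x
    using dom[OF that] F_eq by blast
  show thesis
  proof (rule that[of F])
    show "linear_map_on V F"
      unfolding linear_map_on_def
    proof (intro conjI ballI allI)
      fix x y assume "x \<in> V" "y \<in> V"
      then show "F (x + y) = F x + F y"
        using subspace_add[OF M(1) F_in F_in, of x y] by (simp add: F_eq)
    next
      fix c x assume "x \<in> V"
      then show "F (c *\<^sub>R x) = c *\<^sub>R F x"
        using subspace_scale[OF M(1) F_in, of x c] by (simp add: F_eq)
    qed
    show "F x \<le> 1" if "x \<in> V" "x \<in> C" for x using Mb F_in that by blast
    show "F x = r" if "(x, r) \<in> G0" for x r using that M(2) F_eq by blast
  qed
qed

lemma continuous_map_affine:
  assumes T: "top_vector_space T" and a: "a \<in> topspace T"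
  shows "continuous_map T T (\<lambda>x. c *\<^sub>R (x + a))"
proof -
  have add: "continuous_map (prod_topology T T) T (\<lambda>(x, y). x + y)"
    and scale: "continuous_map (prod_topology euclideanreal T) T (\<lambda>(c, x). c *\<^sub>R x)"
    using T by (auto simp: top_vector_space_def)
  have "continuous_map T T (\<lambda>x. x + a)"
    using continuous_map_compose[OF _ add, of T "\<lambda>x. (x, a)"] a
    by (simp add: o_def continuous_map_pairedI)
  then show ?thesis
    using continuous_map_compose[OF _ scale, of T "\<lambda>x. (c, x + a)"]
    by (simp add: o_def continuous_map_pairedI)
qed

lemma neighbourhood_absorbing:
  assumes T: "top_vector_space T" and U: "openin T U" "0 \<in> U" and v: "v \<in> topspace T"
  shows "\<exists>t>0. t *\<^sub>R v \<in> U"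
proof -
  have scale: "continuous_map (prod_topology euclideanreal T) T (\<lambda>(c, x). c *\<^sub>R x)"
    using T by (auto simp: top_vector_space_def)
  have "continuous_map euclideanreal T (\<lambda>t. t *\<^sub>R v)"
    using continuous_map_compose[OF _ scale, of euclideanreal "\<lambda>t. (t, v)"] v
    by (simp add: o_def continuous_map_pairedI)
  from openin_continuous_map_preimage[OF this U(1)]
  have "open {t. t *\<^sub>R v \<in> U}" by simp
  moreover have "0 \<in> {t. t *\<^sub>R v \<in> U}" using U(2) by simp
  ultimately obtain e where e: "e > 0" "ball 0 e \<subseteq> {t. t *\<^sub>R v \<in> U}"
    using openE by blast
  then have "e / 2 \<in> {t. t *\<^sub>R v \<in> U}" by (intro subsetD[OF e(2)]) simp
  then show ?thesis using e(1) by (intro exI[of _ "e / 2"]) simp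
qed

lemma linear_map_on_diff:
  assumes "linear_map_on V F" "subspace V" "x \<in> V" "y \<in> V"
  shows "F (x - y) = F x - F y"
proof -
  have "F (x + (- 1) *\<^sub>R y) = F x + F ((- 1) *\<^sub>R y)"
    using assms subspace_scale[OF assms(2,4), of "- 1"] unfolding linear_map_on_def by blast
  also have "F ((- 1) *\<^sub>R y) = (- 1) *\<^sub>R F y"
    using assms unfolding linear_map_on_def by blast
  finally show ?thesis by simp
qed

text \<open>
  A one-sided bound on a neighbourhood \<open>U\<close> of \<open>0\<close> suffices: applied to the points \<open>\<plusminus> (2 / e) (y - x)\<close>
  it bounds \<open>F y - F x\<close> by \<open>e / 2\<close> from both sides.
\<close>

lemma continuous_map_linear_bounded_above:
  fixes F :: "'a::real_vector \<Rightarrow> real"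
  assumes T: "top_vector_space T" and F: "linear_map_on (topspace T) F"
    and U: "openin T U" "0 \<in> U" and bound: "\<And>x. x \<in> U \<Longrightarrow> F x \<le> 1"
  shows "continuous_map T euclideanreal F"
proof -
  have V: "subspace (topspace T)" using T by (simp add: top_vector_space_def)
  have nbhd: "\<exists>W. openin T W \<and> x \<in> W \<and> (\<forall>y\<in>W. F y \<in> ball (F x) e)"
    if x: "x \<in> topspace T" and e: "e > 0" for x e
  proof -
    have mx: "- x \<in> topspace T" using subspace_neg[OF V x] .
    define W where "W c = {y \<in> topspace T. c *\<^sub>R (y + (- x)) \<in> U}" for c :: real
    have W_open: "openin T (W c)" for c
      unfolding W_def
      by (rule openin_continuous_map_preimage[OF continuous_map_affine[OF T mx] U(1)])
    have xW: "x \<in> W c" for c using x U(2) by (simp add: W_def)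
    have W_bound: "c * (F y - F x) \<le> 1" if "y \<in> W c" for y c
    proof -
      have y: "y \<in> topspace T" "c *\<^sub>R (y - x) \<in> U" using that by (auto simp: W_def)
      have "F (c *\<^sub>R (y - x)) = c * (F y - F x)"
        using F linear_map_on_diff[OF F V y(1) x] subspace_diff[OF V y(1) x]
        unfolding linear_map_on_def by force
      then show ?thesis using bound[OF y(2)] by simp
    qed
    show ?thesis
    proof (intro exI conjI ballI)
      show "openin T (W (2 / e) \<inter> W (- 2 / e))" using W_open by blast
      show "x \<in> W (2 / e) \<inter> W (- 2 / e)" using xW by blast
      fix y assume "y \<in> W (2 / e) \<inter> W (- 2 / e)"
      then have "(2 / e) * (F y - F x) \<le> 1" "(- 2 / e) * (F y - F x) \<le> 1"
        using W_bound by blast+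
      then show "F y \<in> ball (F x) e" using e by (auto simp: dist_real_def field_simps)
    qed
  qed
  show ?thesis
    unfolding continuous_map
  proof (intro conjI allI impI)
    show "F ` topspace T \<subseteq> topspace euclideanreal" by simp
    fix S :: "real set" assume "openin euclideanreal S"
    then have S: "open S" by simp
    show "openin T {x \<in> topspace T. F x \<in> S}"
    proof (subst openin_subopen, intro ballI)
      fix x assume "x \<in> {x \<in> topspace T. F x \<in> S}"
      then obtain e where e: "x \<in> topspace T" "e > 0" "ball (F x) e \<subseteq> S"
        using S by (auto elim: openE)
      obtain W where W: "openin T W" "x \<in> W" "\<forall>y\<in>W. F y \<in> ball (F x) e"
        using nbhd[OF e(1,2)] by blast
      have "W \<subseteq> {x \<in> topspace T. F x \<in> S}"
        using W(3) e(3) openin_subset[OF W(1)] by blast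
      then show "\<exists>W. openin T W \<and> x \<in> W \<and> W \<subseteq> {x \<in> topspace T. F x \<in> S}"
        using W(1,2) by blast
    qed
  qed
qed

lemma Hahn_Banach_locally_convex:
  fixes G0 :: "('a::real_vector \<times> real) set"
  assumes T: "top_vector_space T" and G0: "subspace G0" "fst ` G0 \<subseteq> topspace T"
    and C: "convex C" "0 \<in> T interior_of C"
    and bound: "\<And>x r. (x, r) \<in> G0 \<Longrightarrow> x \<in> C \<Longrightarrow> r \<le> 1"
  obtains F where "linear_map_on (topspace T) F" "continuous_map T euclideanreal F"
    "\<And>x r. (x, r) \<in> G0 \<Longrightarrow> F x = r"
proof -
  have V: "subspace (topspace T)" using T by (simp add: top_vector_space_def)
  have int: "openin T (T interior_of C)" "T interior_of C \<subseteq> C"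
    by (auto simp: interior_of_subset)
  have absorb: "\<exists>t>0. t *\<^sub>R v \<in> C" if "v \<in> topspace T" for v
    using neighbourhood_absorbing[OF T int(1) C(2) that] int(2) by blast
  obtain F where F: "linear_map_on (topspace T) F" "\<And>x. x \<in> topspace T \<Longrightarrow> x \<in> C \<Longrightarrow> F x \<le> 1"
    "\<And>x r. (x, r) \<in> G0 \<Longrightarrow> F x = r"
    by (rule Hahn_Banach_convex[OF V G0 C(1)]) (use absorb bound in auto)
  have "continuous_map T euclideanreal F"
    by (rule continuous_map_linear_bounded_above[OF T F(1) int(1) C(2)])
       (use F(2) int openin_subset in blast)
  then show thesis using that F by blast
qed

lemma continuous_map_diff_tvs:
  assumes T: "top_vector_space T"
  shows "continuous_map (prod_topology T T) T (\<lambda>(x, y). x - y)"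
proof -
  have add: "continuous_map (prod_topology T T) T (\<lambda>(x, y). x + y)"
    and scale: "continuous_map (prod_topology euclideanreal T) T (\<lambda>(c, x). c *\<^sub>R x)"
    using T by (auto simp: top_vector_space_def)
  have "continuous_map (prod_topology T T) T (\<lambda>z. (- 1) *\<^sub>R snd z)"
    using continuous_map_compose[OF _ scale, of "prod_topology T T" "\<lambda>z. (- 1, snd z)"]
    by (simp add: o_def continuous_map_pairedI continuous_map_snd)
  then have "continuous_map (prod_topology T T) (prod_topology T T) (\<lambda>z. (fst z, (- 1) *\<^sub>R snd z))"
    by (intro continuous_map_pairedI continuous_map_fst)
  from continuous_map_compose[OF this add] show ?thesis
    by (simp add: o_def case_prod_unfold)
qed

text \<open>
  For a point \<open>x\<close> of the closure, the trace on \<open>S\<close> of the neighbourhood filter of \<open>x\<close> is a Cauchy filter.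
  Its limit in \<open>S\<close> must be \<open>x\<close>, since limits in a Hausdorff space are unique.
\<close>

lemma complete_subspace_closedin:
  assumes T: "top_vector_space T" "Hausdorff_space T"
    and S: "subspace S" "S \<subseteq> topspace T" "complete_tvs (subtopology T S)"
  shows "closedin T S"
proof -
  have "x \<in> S" if x: "x \<in> T closure_of S" for x
  proof -
    define F where "F = inf (nhdsin T x) (principal S)"
    have xT: "x \<in> topspace T" using x by (simp add: in_closure_of)
    have ev: "eventually P F \<longleftrightarrow> (\<exists>U. openin T U \<and> x \<in> U \<and> (\<forall>y\<in>U \<inter> S. P y))" for P
      unfolding F_def eventually_inf_principal eventually_nhdsin using xT by auto
    have nontriv: "F \<noteq> bot"
    proof
      assume "F = bot"
      then have "eventually (\<lambda>_. False) F" by simp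
      then obtain U where U: "openin T U" "x \<in> U" "U \<inter> S = {}" unfolding ev by auto
      then show False using x unfolding in_closure_of by auto
    qed
    have "Cauchy_filter_in (subtopology T S) F"
      unfolding Cauchy_filter_in_def
    proof (intro conjI allI impI)
      show "F \<noteq> bot" by (rule nontriv)
      show "eventually (\<lambda>y. y \<in> topspace (subtopology T S)) F"
        unfolding ev using S(2) xT by auto
    next
      fix W assume "openin (subtopology T S) W \<and> 0 \<in> W"
      then obtain W' where W': "openin T W'" "W = W' \<inter> S" "0 \<in> W'"
        by (auto simp: openin_subtopology)
      have "openin (prod_topology T T) {z \<in> topspace (prod_topology T T). (\<lambda>(a, b). a - b) z \<in> W'}"
        by (rule openin_continuous_map_preimage[OF continuous_map_diff_tvs[OF T(1)] W'(1)])
      moreover have "(x, x) \<in> {z \<in> topspace (prod_topology T T). (\<lambda>(a, b). a - b) z \<in> W'}"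
        using xT W'(3) by simp
      ultimately obtain U V where UV: "openin T U" "openin T V" "x \<in> U" "x \<in> V"
        "U \<times> V \<subseteq> {z \<in> topspace (prod_topology T T). (\<lambda>(a, b). a - b) z \<in> W'}"
        unfolding openin_prod_topology_alt by meson
      have "eventually (\<lambda>a. a \<in> U \<inter> V \<inter> S) F"
        unfolding ev by (rule exI[of _ "U \<inter> V"]) (use UV(1-4) in auto)
      moreover have "(\<lambda>(a, b). a - b \<in> W) (a, b)" if "a \<in> U \<inter> V \<inter> S" "b \<in> U \<inter> V \<inter> S" for a b
        using subsetD[OF UV(5), of "(a, b)"] subspace_diff[OF S(1), of a b] that W'(2) by simp
      ultimately show "eventually (\<lambda>(a, b). a - b \<in> W) (F \<times>\<^sub>F F)"
        unfolding eventually_prod_filter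
        by (intro exI[of _ "\<lambda>a. a \<in> U \<inter> V \<inter> S"] conjI) simp_all
    qed
    then obtain l where "limitin (subtopology T S) (\<lambda>y. y) l F"
      using S(3) by (auto simp: complete_tvs_def)
    then have l: "l \<in> S" "limitin T (\<lambda>y. y) l F" by (auto simp: limitin_subtopology)
    have "limitin T (\<lambda>y. y) x F"
      unfolding limitin_def ev
    proof (intro conjI allI impI)
      show "\<exists>V. openin T V \<and> x \<in> V \<and> (\<forall>y\<in>V \<inter> S. y \<in> U)" if "openin T U \<and> x \<in> U" for U
        using that by (intro exI[of _ U]) simp
    qed (rule xT)
    then have "l = x" using limitin_Hausdorff_unique[OF l(2) _ nontriv T(2)] by simp
    then show "x \<in> S" using l(1) by simp
  qed
  then have "T closure_of S \<subseteq> S" by blast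
  with S(2) show ?thesis by (simp add: closure_of_subset_eq[symmetric])
qed

text \<open>
  The functional \<open>w + t x \<mapsto> t\<close> is bounded by \<open>1\<close> on a convex neighbourhood of \<open>0\<close> that misses
  the closed set \<open>x + W\<close>, because shrinking a point \<open>w + t x\<close> of the
  neighbourhood with \<open>t > 1\<close> by the factor \<open>1 / t\<close> would lead into \<open>x + W\<close>.
\<close>

lemma exists_functional_separating_closed_subspace:
  assumes T: "locally_convex_space T" and W: "subspace W" "closedin T W"
    and x: "x \<in> topspace T" "x \<notin> W"
  obtains F :: "'a::real_vector \<Rightarrow> real" where "linear_map_on (topspace T) F"
    "continuous_map T euclideanreal F" "\<forall>w\<in>W. F w = 0" "F x = 1"
proof -
  have tvs: "top_vector_space T" and V: "subspace (topspace T)"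
    using T by (auto simp: locally_convex_space_def top_vector_space_def)
  have WV: "W \<subseteq> topspace T" using W(2) by (rule closedin_subset)
  \<comment> \<open>The complement of \<open>x + W\<close>, as the preimage of an open set under an affine map.\<close>
  define U where "U = {y \<in> topspace T. 1 *\<^sub>R (y + (- x)) \<in> topspace T - W}"
  have "openin T U"
    unfolding U_def
    by (rule openin_continuous_map_preimage[OF continuous_map_affine[OF tvs subspace_neg[OF V x(1)]]])
       (use W(2) in blast)
  moreover have "0 \<in> U"
    using subspace_neg[OF V x(1)] subspace_neg[OF W(1), of "- x"] x subspace_0[OF V]
    by (auto simp: U_def)
  ultimately obtain C where C: "convex C" "C \<subseteq> U" "0 \<in> T interior_of C"
    using T unfolding locally_convex_space_def by blast
  have zero_C: "0 \<in> C" by (rule subsetD[OF interior_of_subset C(3)])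
  define G0 where "G0 = span (insert (x, 1) (W \<times> {0 :: real}))"
  have WS: "subspace (W \<times> {0 :: real})" using W(1) by (intro subspace_Times) auto
  have sup: "insert (x, 1) (W \<times> {0}) \<subseteq> G0" unfolding G0_def by (rule span_superset)
  have G0_sub: "G0 \<subseteq> topspace T \<times> UNIV"
    unfolding G0_def by (rule span_minimal) (use x WV V in \<open>auto simp: subspace_Times\<close>)
  have G0_bound: "r \<le> 1" if yr: "(y, r) \<in> G0" and y: "y \<in> C" for y r
  proof (rule ccontr)
    assume r: "\<not> r \<le> 1"
    obtain k where "(y, r) - k *\<^sub>R (x, 1) \<in> span (W \<times> {0})"
      using yr unfolding G0_def span_breakdown_eq by blast
    \<comment> \<open>Comparison of the second components gives \<open>k = r\<close>.\<close>
    then have yW: "y - r *\<^sub>R x \<in> W"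
      by (auto simp: span_eq_iff[THEN iffD2, OF WS])
    then have "(1 / r) *\<^sub>R (y - r *\<^sub>R x) \<in> W" using subspace_scale[OF W(1)] by blast
    then have "(1 / r) *\<^sub>R y - x \<in> W" using r by (simp add: scaleR_diff_right)
    moreover have "(1 / r) *\<^sub>R y \<in> C"
      using convexD[OF C(1) y zero_C, of "1 / r" "1 - 1 / r"] r by (simp add: field_simps)
    ultimately show False using C(2) by (auto simp: U_def)
  qed
  obtain F where F: "linear_map_on (topspace T) F" "continuous_map T euclideanreal F"
    "\<And>y r. (y, r) \<in> G0 \<Longrightarrow> F y = r"
  proof (rule Hahn_Banach_locally_convex[OF tvs _ _ C(1,3), of G0])
    show "subspace G0" by (simp add: G0_def)
    show "fst ` G0 \<subseteq> topspace T" using G0_sub by auto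
  qed (use G0_bound in auto)
  show thesis using F(3) sup by (intro that[OF F(1,2)]) auto
qed

text \<open>
  Continuity on \<open>W\<close> makes \<open>{w \<in> W. F w < 1}\<close> the trace of an open set \<open>U\<close> of the whole space;
  local convexity yields a convex neighbourhood of \<open>0\<close> inside \<open>U\<close> on which the graph of \<open>F\<close> is bounded by \<open>1\<close>.
\<close>

lemma extend_continuous_functional:
  fixes F :: "'a::real_vector \<Rightarrow> real"
  assumes T: "locally_convex_space T" and W: "subspace W" "W \<subseteq> topspace T"
    and F: "linear_map_on W F" "continuous_map (subtopology T W) euclideanreal F"
  obtains F' where "linear_map_on (topspace T) F'" "continuous_map T euclideanreal F'"
    "\<And>w. w \<in> W \<Longrightarrow> F' w = F w"
proof -
  have tvs: "top_vector_space T"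
    using T by (auto simp: locally_convex_space_def)
  have top: "topspace (subtopology T W) = W" using W(2) by auto
  have "openin (subtopology T W) {w \<in> topspace (subtopology T W). F w \<in> {..<1}}"
    by (rule openin_continuous_map_preimage[OF F(2)]) simp
  then obtain U where U: "openin T U" "{w \<in> W. F w < 1} = U \<inter> W"
    unfolding top openin_subtopology by auto
  have F0: "F 0 = 0"
    using F(1) subspace_0[OF W(1)] unfolding linear_map_on_def by (metis scaleR_zero_left)
  have "0 \<in> {w \<in> W. F w < 1}" using subspace_0[OF W(1)] F0 by simp
  then have "0 \<in> U" unfolding U(2) by blast
  then obtain C where C: "convex C" "C \<subseteq> U" "0 \<in> T interior_of C"
    using T U(1) unfolding locally_convex_space_def by blast
  define G0 where "G0 = (\<lambda>w. (w, F w)) ` W"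
  have G0_subspace: "subspace G0"
  proof (rule subspaceI)
    show "0 \<in> G0" using subspace_0[OF W(1)] F0 by (force simp: G0_def zero_prod_def)
  next
    fix p q assume "p \<in> G0" "q \<in> G0"
    then obtain v w where "v \<in> W" "w \<in> W" "p = (v, F v)" "q = (w, F w)" by (auto simp: G0_def)
    then show "p + q \<in> G0"
      using F(1) subspace_add[OF W(1), of v w] by (auto simp: G0_def linear_map_on_def)
  next
    fix c p assume "p \<in> G0"
    then obtain w where "w \<in> W" "p = (w, F w)" by (auto simp: G0_def)
    then show "c *\<^sub>R p \<in> G0"
      using F(1) subspace_scale[OF W(1), of w c] by (auto simp: G0_def linear_map_on_def)
  qed
  have G0_bound: "r \<le> 1" if "(x, r) \<in> G0" "x \<in> C" for x r
  proof -
    have "x \<in> {w \<in> W. F w < 1}" unfolding U(2) using that C(2) by (auto simp: G0_def)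
    then show ?thesis using that(1) by (auto simp: G0_def)
  qed
  obtain F' where F': "linear_map_on (topspace T) F'" "continuous_map T euclideanreal F'"
    "\<And>y r. (y, r) \<in> G0 \<Longrightarrow> F' y = r"
  proof (rule Hahn_Banach_locally_convex[OF tvs G0_subspace _ C(1,3)])
    show "fst ` G0 \<subseteq> topspace T" using W(2) by (auto simp: G0_def)
  qed (use G0_bound in auto)
  show thesis using F'(3) by (intro that[OF F'(1,2)]) (auto simp: G0_def)
qed

section \<open>Functionals on strict inductive limits\<close>

text \<open>
  The coarsest topology that makes \<open>f\<close> continuous; it serves as a competitor in the definition of the
  inductive limit topology.
\<close>

lemma locally_convex_pullback:
  fixes f :: "'a::real_vector \<Rightarrow> real"
  assumes f: "linear f"
  shows "locally_convex_space (pullback_topology UNIV f euclideanreal)" (is "locally_convex_space ?S")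
proof -
  have top: "topspace ?S = UNIV" by (simp add: topspace_pullback_topology)
  have f_cont: "continuous_map ?S euclideanreal f"
    using continuous_map_pullback[OF continuous_map_id, of UNIV f euclideanreal] by (simp add: o_def id_def)
  have into: "continuous_map X ?S g" if "continuous_map X euclideanreal (f \<circ> g)" for X and g :: "'c \<Rightarrow> 'a"
    using that by (rule continuous_map_pullback') auto
  have "continuous_map (prod_topology ?S ?S) euclideanreal (f \<circ> (\<lambda>(x, y). x + y))"
  proof -
    have "continuous_map (prod_topology ?S ?S) euclideanreal (\<lambda>z. f (fst z) + f (snd z))"
      by (intro continuous_map_add continuous_map_compose[OF continuous_map_fst f_cont, unfolded o_def]
          continuous_map_compose[OF continuous_map_snd f_cont, unfolded o_def])
    then show ?thesis by (simp add: o_def case_prod_unfold linear_add[OF f])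
  qed
  moreover have "continuous_map (prod_topology euclideanreal ?S) euclideanreal (f \<circ> (\<lambda>(c, x). c *\<^sub>R x))"
  proof -
    have "continuous_map (prod_topology euclideanreal ?S) euclideanreal (\<lambda>z. fst z * f (snd z))"
      by (intro continuous_map_real_mult continuous_map_fst
          continuous_map_compose[OF continuous_map_snd f_cont, unfolded o_def])
    then show ?thesis by (simp add: o_def case_prod_unfold linear_cmul[OF f])
  qed
  ultimately have tvs: "top_vector_space ?S"
    unfolding top_vector_space_def top by (auto intro: into)
  have "\<exists>C. convex C \<and> C \<subseteq> U \<and> 0 \<in> ?S interior_of C" if U: "openin ?S U" "0 \<in> U" for U
  proof -
    obtain O' where O': "open O'" "U = f -` O'"
      using U(1) by (auto simp: openin_pullback_topology)
    have "0 \<in> O'" using U(2) O'(2) linear_0[OF f] by auto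
    then obtain e where e: "e > 0" "ball 0 e \<subseteq> O'" using O'(1) openE by blast
    have "convex (f -` ball 0 e)" by (rule convex_linear_vimage[OF f convex_ball])
    moreover have "openin ?S (f -` ball 0 e)"
      unfolding openin_pullback_topology by (rule exI[of _ "ball 0 e"]) auto
    moreover have "0 \<in> f -` ball 0 e" using e(1) linear_0[OF f] by simp
    ultimately show ?thesis using e(2) O'(2)
      by (intro exI[of _ "f -` ball 0 e"]) (auto simp: interior_of_openin)
  qed
  then show ?thesis using tvs by (simp add: locally_convex_space_def)
qed

text \<open>
  The pullback topology along \<open>f\<close> is compatible with the steps exactly because \<open>f\<close> is continuous on
  each of them, so by maximality the limit topology is finer and \<open>f\<close> is continuous for it.
\<close>

lemma inductive_limit_dual_iff:
  fixes \<tau> :: "'a::real_vector topology"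
  assumes \<tau>: "inductive_limit_topology T \<tau>"
  shows "f \<in> continuous_dual \<tau> \<longleftrightarrow> linear f \<and> (\<forall>n. continuous_map (T n) euclideanreal f)"
proof
  have top_\<tau>: "topspace \<tau> = UNIV"
    using \<tau> by (simp add: inductive_limit_topology_def compatible_lc_topology_def)
  assume f: "f \<in> continuous_dual \<tau>"
  then have f_cont: "continuous_map \<tau> euclideanreal f" by (simp add: continuous_dual_def)
  have "continuous_map (T n) euclideanreal f" for n
    unfolding continuous_map
  proof (intro conjI allI impI)
    fix S :: "real set" assume "openin euclideanreal S"
    then have "openin \<tau> {x. f x \<in> S}"
      using openin_continuous_map_preimage[OF f_cont] top_\<tau> by simp
    then have "openin (subtopology \<tau> (topspace (T n))) ({x. f x \<in> S} \<inter> topspace (T n))"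
      unfolding openin_subtopology by blast
    then have "openin (T n) ({x. f x \<in> S} \<inter> topspace (T n))"
      using \<tau> by (simp add: inductive_limit_topology_def compatible_lc_topology_def coarser_eq_def)
    moreover have "{x. f x \<in> S} \<inter> topspace (T n) = {x \<in> topspace (T n). f x \<in> S}" by blast
    ultimately show "openin (T n) {x \<in> topspace (T n). f x \<in> S}" by simp
  qed simp
  then show "linear f \<and> (\<forall>n. continuous_map (T n) euclideanreal f)"
    using f by (simp add: continuous_dual_def)
next
  assume "linear f \<and> (\<forall>n. continuous_map (T n) euclideanreal f)"
  then have f: "linear f" and cont: "\<And>n. continuous_map (T n) euclideanreal f" by auto
  define \<sigma> where "\<sigma> = pullback_topology UNIV f euclideanreal"
  have top: "topspace \<sigma> = UNIV" by (simp add: \<sigma>_def topspace_pullback_topology)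
  have "compatible_lc_topology T \<sigma>"
    unfolding compatible_lc_topology_def coarser_eq_def
  proof (intro conjI allI impI)
    show "locally_convex_space \<sigma>" unfolding \<sigma>_def by (rule locally_convex_pullback[OF f])
    fix n U assume "openin (subtopology \<sigma> (topspace (T n))) U"
    then obtain S where S: "open S" "U = {x \<in> topspace (T n). f x \<in> S}"
      by (auto simp: openin_subtopology \<sigma>_def openin_pullback_topology)
    then show "openin (T n) U"
      using openin_continuous_map_preimage[OF cont] by simp
  qed (simp_all add: top)
  then have "coarser_eq \<sigma> \<tau>" using \<tau> by (simp add: inductive_limit_topology_def)
  then have open_imp: "openin \<tau> U" if "openin \<sigma> U" for U
    using that by (simp add: coarser_eq_def)
  have top_\<tau>: "topspace \<tau> = UNIV"
    using \<tau> by (simp add: inductive_limit_topology_def compatible_lc_topology_def)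
  have "openin \<tau> {x. f x \<in> S}" if "open S" for S
    by (rule open_imp) (use that in \<open>auto simp: \<sigma>_def openin_pullback_topology\<close>)
  then show "f \<in> continuous_dual \<tau>" using f by (simp add: continuous_dual_def continuous_map top_\<tau>)
qed

locale strict_inductive_sequence =
  fixes T :: "nat \<Rightarrow> 'a::real_vector topology" and \<tau> :: "'a topology"
  assumes LF: "LF_sequence T" and lim: "inductive_limit_topology T \<tau>"
    and strict: "\<And>n. subtopology (T (Suc n)) (topspace (T n)) = T n"
begin

lemma Frechet: "Frechet_space (T n)"
  and step_psubset: "topspace (T n) \<subset> topspace (T (Suc n))"
  and covering: "\<exists>n. x \<in> topspace (T n)"
  using LF by (auto simp: LF_sequence_def)

lemma locally_convex: "locally_convex_space (T n)"
  and tvs: "top_vector_space (T n)"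
  and step_subspace: "subspace (topspace (T n))"
  using Frechet[of n] by (auto simp: Frechet_space_def locally_convex_space_def top_vector_space_def)

lemma step_mono: "m \<le> n \<Longrightarrow> topspace (T m) \<subseteq> topspace (T n)"
  using lift_Suc_mono_le[of "\<lambda>n. topspace (T n)", OF psubset_imp_subset[OF step_psubset]] .

lemma strict_le: "m \<le> n \<Longrightarrow> subtopology (T n) (topspace (T m)) = T m"
proof (induction n rule: dec_induct)
  case (step n)
  have "subtopology (T (Suc n)) (topspace (T m))
      = subtopology (subtopology (T (Suc n)) (topspace (T n))) (topspace (T m))"
    using step_mono[OF step(1)] by (simp add: subtopology_subtopology inf_absorb2)
  also have "\<dots> = T m" by (simp only: strict step.IH)
  finally show ?case .
qed simp

lemma step_closedin: "closedin (T (Suc n)) (topspace (T n))"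
proof (rule complete_subspace_closedin)
  show "Hausdorff_space (T (Suc n))"
    using Frechet[of "Suc n"] by (simp add: Frechet_space_def metrizable_imp_Hausdorff_space)
  show "complete_tvs (subtopology (T (Suc n)) (topspace (T n)))"
    using Frechet[of n] by (simp only: strict Frechet_space_def)
  show "topspace (T n) \<subseteq> topspace (T (Suc n))" by (rule psubset_imp_subset[OF step_psubset])
qed (rule tvs, rule step_subspace)

text \<open>
  The extensions to the successive steps are chosen one after the other, and their union is
  continuous on each step, hence on the limit. Stage \<open>k\<close> of the choice lives on step \<open>m + k\<close>.
\<close>

lemma extend_from_step:
  assumes F: "linear_map_on (topspace (T m)) F" "continuous_map (T m) euclideanreal F"
  obtains f where "f \<in> continuous_dual \<tau>" "\<And>x. x \<in> topspace (T m) \<Longrightarrow> f x = F x"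
proof -
  define P where "P k g \<longleftrightarrow> linear_map_on (topspace (T (m + k))) g \<and>
    continuous_map (T (m + k)) euclideanreal g \<and> (\<forall>x\<in>topspace (T m). g x = F x)" for k g
  have base: "\<exists>g. P 0 g" using F by (auto simp: P_def)
  have step: "\<exists>g'. P (Suc k) g' \<and> (\<forall>x\<in>topspace (T (m + k)). g' x = g x)" if g: "P k g" for k g
  proof -
    have "continuous_map (subtopology (T (Suc (m + k))) (topspace (T (m + k)))) euclideanreal g"
      using g by (simp add: strict P_def)
    moreover have "linear_map_on (topspace (T (m + k))) g" using g by (simp add: P_def)
    ultimately obtain g' where g': "linear_map_on (topspace (T (Suc (m + k)))) g'"
      "continuous_map (T (Suc (m + k))) euclideanreal g'" "\<And>x. x \<in> topspace (T (m + k)) \<Longrightarrow> g' x = g x"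
      using extend_continuous_functional[OF locally_convex step_subspace
          psubset_imp_subset[OF step_psubset]] by blast
    have "g' x = F x" if "x \<in> topspace (T m)" for x
      using g'(3)[of x] g step_mono[of m "m + k"] that by (auto simp: P_def)
    then show ?thesis using g' by (intro exI[of _ g']) (simp add: P_def)
  qed
  have "\<exists>G. \<forall>k. P k (G k) \<and> (\<forall>x\<in>topspace (T (m + k)). G (Suc k) x = G k x)"
    by (rule dependent_nat_choice[of P "\<lambda>k g g'. \<forall>x\<in>topspace (T (m + k)). g' x = g x"])
      (rule base, rule step)
  then obtain G where G: "\<And>k. P k (G k)"
    and G_Suc: "\<And>k x. x \<in> topspace (T (m + k)) \<Longrightarrow> G (Suc k) x = G k x"
    by metis
  have G_le: "G l x = G k x" if "k \<le> l" "x \<in> topspace (T (m + k))" for k l x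
    using that(1)
  proof (induction l rule: dec_induct)
    case (step l)
    have "x \<in> topspace (T (m + l))" using that(2) step(1) step_mono[of "m + k" "m + l"] by auto
    then show ?case using G_Suc step.IH by simp
  qed simp
  have cover: "\<exists>k. x \<in> topspace (T (m + k))" for x
  proof -
    obtain n where "x \<in> topspace (T n)" using covering by blast
    then show ?thesis using step_mono[of n "m + n"] by auto
  qed
  define f where "f x = G (LEAST k. x \<in> topspace (T (m + k))) x" for x
  have f_eq: "f x = G k x" if "x \<in> topspace (T (m + k))" for x k
  proof -
    let ?l = "LEAST k. x \<in> topspace (T (m + k))"
    have "?l \<le> k" using that by (rule Least_le)
    moreover have "x \<in> topspace (T (m + ?l))" using that by (rule LeastI)
    ultimately show ?thesis unfolding f_def by (rule G_le[symmetric])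
  qed
  have "linear f"
  proof (rule linearI)
    fix x y
    obtain i j where "x \<in> topspace (T (m + i))" "y \<in> topspace (T (m + j))" using cover by blast
    then have "x \<in> topspace (T (m + max i j))" "y \<in> topspace (T (m + max i j))"
      using step_mono[of "m + i" "m + max i j"] step_mono[of "m + j" "m + max i j"] by auto
    then show "f (x + y) = f x + f y"
      using f_eq[of _ "max i j"] G[of "max i j"] subspace_add[OF step_subspace] unfolding P_def linear_map_on_def by simp
  next
    fix c x
    obtain i where "x \<in> topspace (T (m + i))" using cover by blast
    then show "f (c *\<^sub>R x) = c *\<^sub>R f x"
      using f_eq[of _ i] G[of i] subspace_scale[OF step_subspace] unfolding P_def linear_map_on_def by simp
  qed
  moreover have "continuous_map (T n) euclideanreal f" for n
  proof -
    have "continuous_map (T (m + n)) euclideanreal f"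
      using G[of n] f_eq[of _ n] continuous_map_eq[of "T (m + n)" euclideanreal "G n" f]
      unfolding P_def by auto
    then have "continuous_map (subtopology (T (m + n)) (topspace (T n))) euclideanreal f"
      by (rule continuous_map_from_subtopology)
    then show ?thesis by (simp add: strict_le)
  qed
  ultimately have "f \<in> continuous_dual \<tau>" using inductive_limit_dual_iff[OF lim] by blast
  moreover have "f x = F x" if "x \<in> topspace (T m)" for x
    using f_eq[of x 0] G[of 0] that by (simp add: P_def)
  ultimately show thesis by (rule that)
qed

lemma exists_dual_vanishing_on_step:
  assumes x: "x \<in> topspace (T (Suc n)) - topspace (T n)"
  obtains f where "f \<in> continuous_dual \<tau>" "\<And>w. w \<in> topspace (T n) \<Longrightarrow> f w = 0" "f x = 1"
proof -
  obtain F where F: "linear_map_on (topspace (T (Suc n))) F" "continuous_map (T (Suc n)) euclideanreal F"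
    "\<forall>w\<in>topspace (T n). F w = 0" "F x = (1 :: real)"
    using exists_functional_separating_closed_subspace[OF locally_convex step_subspace step_closedin] x
    by blast
  obtain f where f: "f \<in> continuous_dual \<tau>" "\<And>y. y \<in> topspace (T (Suc n)) \<Longrightarrow> f y = F y"
    using extend_from_step[OF F(1,2)] by blast
  show thesis
  proof (rule that[OF f(1)])
    show "f w = 0" if "w \<in> topspace (T n)" for w
      using f(2)[of w] F(3) step_mono[of n "Suc n"] that by auto
    show "f x = 1" using f(2)[of x] F(4) x by simp
  qed
qed

text \<open>
  Arbitrary coefficients are admissible: on step \<open>k\<close> only the functionals \<open>f n\<close> with \<open>n < k\<close> are
  nonzero, so that the series is there a fixed finite sum of continuous functionals.
\<close>

lemma locally_finite_combination_in_dual: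
  assumes dual: "\<And>n. f n \<in> continuous_dual \<tau>"
    and vanish: "\<And>n w. w \<in> topspace (T n) \<Longrightarrow> f n w = 0"
  shows "(\<lambda>v. \<Sum>n | f n v \<noteq> 0. a n * f n v) \<in> continuous_dual \<tau>"
    and "finite {n. f n v \<noteq> 0}"
proof -
  define h where "h v = (\<Sum>n | f n v \<noteq> 0. a n * f n v)" for v
  have lin: "linear (f n)" and cont: "continuous_map (T k) euclideanreal (f n)" for n k
    using dual[of n] inductive_limit_dual_iff[OF lim] by auto
  have support: "{n. f n v \<noteq> 0} \<subseteq> {..<k}" if "v \<in> topspace (T k)" for v k
  proof
    fix n assume n: "n \<in> {n. f n v \<noteq> 0}"
    show "n \<in> {..<k}"
    proof (rule ccontr)
      assume "n \<notin> {..<k}"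
      then have "v \<in> topspace (T n)" using subsetD[OF step_mono that, of n] by simp
      then show False using vanish n by simp
    qed
  qed
  show "finite {n. f n v \<noteq> 0}" for v
    using covering[of v] support finite_subset by blast
  have h_eq: "h v = (\<Sum>n<k. a n * f n v)" if "v \<in> topspace (T k)" for v k
    unfolding h_def by (rule sum.mono_neutral_left) (use support[OF that] in auto)
  have "linear h"
  proof (rule linearI)
    fix u v
    obtain i j where ij: "u \<in> topspace (T i)" "v \<in> topspace (T j)" using covering by blast
    have u: "u \<in> topspace (T (max i j))" by (rule subsetD[OF step_mono ij(1)]) simp
    have v: "v \<in> topspace (T (max i j))" by (rule subsetD[OF step_mono ij(2)]) simp
    show "h (u + v) = h u + h v"
      unfolding h_eq[OF u] h_eq[OF v] h_eq[OF subspace_add[OF step_subspace u v]]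
      by (simp add: linear_add[OF lin] distrib_left sum.distrib)
  next
    fix c v
    obtain k where v: "v \<in> topspace (T k)" using covering by blast
    show "h (c *\<^sub>R v) = c *\<^sub>R h v"
      unfolding h_eq[OF v] h_eq[OF subspace_scale[OF step_subspace v]]
      by (simp add: linear_cmul[OF lin] sum_distrib_left mult.left_commute)
  qed
  moreover have "continuous_map (T k) euclideanreal h" for k
  proof (rule continuous_map_eq)
    show "continuous_map (T k) euclideanreal (\<lambda>v. \<Sum>n<k. a n * f n v)"
      by (intro continuous_map_sum finite_lessThan continuous_map_real_mult_left cont)
  qed (simp add: h_eq)
  ultimately have "h \<in> continuous_dual \<tau>" using inductive_limit_dual_iff[OF lim] by blast
  then show "(\<lambda>v. \<Sum>n | f n v \<noteq> 0. a n * f n v) \<in> continuous_dual \<tau>"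
    by (simp add: h_def[abs_def])
qed

end

section \<open>Biorthogonal systems with pointwise finite series\<close>

text \<open>
  Gauss elimination without recursion on the vectors: starting from \<open>x m\<close>, subtract multiples of
  \<open>x (m - 1), \<dots>, x 0\<close> in this order. By triangularity, correcting the value at \<open>g i\<close> with \<open>x i\<close>
  does not disturb the values at \<open>g n\<close> for \<open>n > i\<close>.
\<close>

lemma exists_biorthogonal_vector:
  fixes g :: "nat \<Rightarrow> 'a::real_vector \<Rightarrow> real"
  assumes lin: "\<And>n. linear (g n)" and diag: "\<And>n. g n (x n) = 1"
    and tri: "\<And>m n. m < n \<Longrightarrow> g n (x m) = 0"
  shows "\<exists>y. \<forall>n. g n y = (if n = m then 1 else 0)"
proof -
  have "\<exists>y. \<forall>n\<ge>m - k. g n y = (if n = m then 1 else 0)" for k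
  proof (induction k)
    case 0
    then show ?case using diag tri by (intro exI[of _ "x m"]) auto
  next
    case (Suc k)
    then obtain y where y: "\<And>n. n \<ge> m - k \<Longrightarrow> g n y = (if n = m then 1 else 0)" by blast
    show ?case
    proof (cases "k < m")
      case True
      \<comment> \<open>The largest index at which \<open>y\<close> may still have the wrong value.\<close>
      define i where "i = m - Suc k"
      have i: "m - k = Suc i" "i < m" using True by (auto simp: i_def)
      have "g n (y - g i y *\<^sub>R x i) = (if n = m then 1 else 0)" if "n \<ge> i" for n
      proof (cases "n = i")
        case True
        then show ?thesis using i(2) diag[of i] by (simp add: linear_diff[OF lin] linear_cmul[OF lin])
      next
        case False
        then have "g n (x i) = 0" "g n y = (if n = m then 1 else 0)"
          using tri[of i n] y[of n] i(1) that by auto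
        then show ?thesis by (simp add: linear_diff[OF lin] linear_cmul[OF lin])
      qed
      then show ?thesis unfolding i_def by blast
    next
      case False
      then show ?thesis using y by (intro exI[of _ y]) auto
    qed
  qed
  from this[of m] show ?thesis by simp
qed

text \<open>
  \<open>D\<close> stands for a dual space. The sum over \<open>{n. f n v \<noteq> 0}\<close> is the pointwise finite series with
  arbitrary coefficients \<open>a\<close>, written without reference to a limit.
\<close>

locale biorthogonal_system =
  fixes D :: "('a \<Rightarrow> real) set" and f :: "nat \<Rightarrow> 'a \<Rightarrow> real" and y :: "nat \<Rightarrow> 'a"
  assumes finite_support: "\<And>v. finite {n. f n v \<noteq> 0}"
    and biorthogonal: "\<And>n m. f n (y m) = (if n = m then 1 else 0)"
    and combinations_in: "\<And>a. (\<lambda>v. \<Sum>n | f n v \<noteq> 0. a n * f n v) \<in> D"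
begin

definition pointwise_topology :: "('a \<Rightarrow> real) topology" where
  "pointwise_topology = subtopology (powertop_real UNIV) D"

definition synthesis :: "(nat \<Rightarrow> real) \<Rightarrow> 'a \<Rightarrow> real" where
  "synthesis a = (\<lambda>v. \<Sum>n | f n v \<noteq> 0. a n * f n v)"

definition analysis :: "('a \<Rightarrow> real) \<Rightarrow> nat \<Rightarrow> real" where
  "analysis g = (\<lambda>n. g (y n))"

lemma topspace_pointwise_topology: "topspace pointwise_topology = D"
  by (simp add: pointwise_topology_def)

lemma synthesis_in: "synthesis a \<in> D"
  unfolding synthesis_def by (rule combinations_in)

lemma synthesis_eq_sum:
  assumes "finite I" "{n. f n v \<noteq> 0} \<subseteq> I"
  shows "synthesis a v = (\<Sum>n\<in>I. a n * f n v)"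
  unfolding synthesis_def by (rule sum.mono_neutral_left) (use assms in auto)

lemma analysis_synthesis: "analysis (synthesis a) = a"
proof
  fix m
  have "synthesis a (y m) = (\<Sum>n\<in>{m}. a n * f n (y m))"
    by (rule synthesis_eq_sum) (auto simp: biorthogonal)
  then show "analysis (synthesis a) m = a m" by (simp add: analysis_def biorthogonal)
qed

lemma synthesis_add: "synthesis (a + b) = synthesis a + synthesis b"
  by (simp add: fun_eq_iff synthesis_def distrib_right sum.distrib)

lemma synthesis_scale: "synthesis (c *\<^sub>R a) = c *\<^sub>R synthesis a"
  by (simp add: fun_eq_iff synthesis_def sum_distrib_left mult.assoc)

lemma linear_synthesis: "linear synthesis"
  by (rule linearI) (fact synthesis_add synthesis_scale)+

lemma subspace_range_synthesis: "subspace (range synthesis)"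
  by (rule linear_subspace_image[OF linear_synthesis subspace_UNIV])

lemma basis_eq_synthesis: "f m = synthesis (\<lambda>n. if n = m then 1 else 0)"
proof
  fix v
  have "synthesis (\<lambda>n. if n = m then 1 else 0) v
      = (\<Sum>n\<in>insert m {n. f n v \<noteq> 0}. (if n = m then 1 else 0) * f n v)"
    by (rule synthesis_eq_sum) (auto simp: finite_support)
  also have "\<dots> = (\<Sum>n\<in>{m}. (if n = m then 1 else 0) * f n v)"
    by (rule sum.mono_neutral_right) (auto simp: finite_support)
  finally show "f m v = synthesis (\<lambda>n. if n = m then 1 else 0) v" by simp
qed

lemma synthesis_analysis: "g \<in> range synthesis \<Longrightarrow> synthesis (analysis g) = g"
  using analysis_synthesis by auto

lemma continuous_map_evaluation: "continuous_map pointwise_topology euclideanreal (\<lambda>g. g v)"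
  unfolding pointwise_topology_def
  by (intro continuous_map_from_subtopology continuous_map_product_projection) simp

lemma continuous_map_analysis: "continuous_map pointwise_topology (powertop_real UNIV) analysis"
  by (simp add: continuous_map_componentwise_UNIV analysis_def continuous_map_evaluation)

lemma continuous_map_synthesis: "continuous_map (powertop_real UNIV) pointwise_topology synthesis"
  unfolding pointwise_topology_def
proof (rule continuous_map_into_subtopology)
  show "continuous_map (powertop_real UNIV) (powertop_real UNIV) synthesis"
    unfolding continuous_map_componentwise_UNIV
  proof
    fix v
    show "continuous_map (powertop_real UNIV) euclideanreal (\<lambda>a. synthesis a v)"
      unfolding synthesis_def
      by (intro continuous_map_sum finite_support continuous_map_real_mult_right
          continuous_map_product_projection) simp
  qed
qed (use synthesis_in in auto)

text \<open>
  \<open>synthesis\<close> embeds the sequence space and \<open>analysis\<close> is a continuous left inverse defined on all of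
  \<open>D\<close>, so that \<open>synthesis \<circ> analysis\<close> is a continuous projection onto the embedded copy.
\<close>

lemma contains_complemented_copy_power:
  "contains_complemented_copy pointwise_topology (powertop_real (UNIV :: nat set))"
  unfolding contains_complemented_copy_def
proof (intro exI[of _ "range synthesis"] conjI)
  show "subspace (range synthesis)" by (rule subspace_range_synthesis)
  show sub: "range synthesis \<subseteq> topspace pointwise_topology" using synthesis_in by (auto simp: topspace_pointwise_topology)
  have "homeomorphic_maps (subtopology pointwise_topology (range synthesis)) (powertop_real UNIV) analysis synthesis"
    unfolding homeomorphic_maps_def
    using continuous_map_analysis continuous_map_synthesis
    by (auto simp: continuous_map_from_subtopology continuous_map_in_subtopology
        synthesis_analysis analysis_synthesis)
  then have "homeomorphic_map (subtopology pointwise_topology (range synthesis)) (powertop_real UNIV) analysis"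
    using homeomorphic_map_maps by blast
  moreover have "linear_map_on (topspace (subtopology pointwise_topology (range synthesis))) analysis"
    by (auto simp: linear_map_on_def analysis_def fun_eq_iff)
  ultimately show "linearly_homeomorphic (subtopology pointwise_topology (range synthesis)) (powertop_real (UNIV :: nat set))"
    unfolding linearly_homeomorphic_def by blast
  have lin: "analysis (g + h) = analysis g + analysis h" "analysis (c *\<^sub>R g) = c *\<^sub>R analysis g" for g h c
    by (auto simp: analysis_def fun_eq_iff)
  have "continuous_projection pointwise_topology (synthesis \<circ> analysis)"
    unfolding continuous_projection_def linear_map_on_def
  proof (intro conjI ballI allI)
    show "continuous_map pointwise_topology pointwise_topology (synthesis \<circ> analysis)"
      by (rule continuous_map_compose[OF continuous_map_analysis continuous_map_synthesis])
  qed (simp_all only: o_apply lin synthesis_add synthesis_scale analysis_synthesis)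
  moreover have "(synthesis \<circ> analysis) ` topspace pointwise_topology = range synthesis"
  proof
    show "range synthesis \<subseteq> (synthesis \<circ> analysis) ` topspace pointwise_topology"
    proof
      fix g assume "g \<in> range synthesis"
      then show "g \<in> (synthesis \<circ> analysis) ` topspace pointwise_topology"
        using sub by (intro image_eqI[of _ _ g]) (auto simp: synthesis_analysis)
    qed
  qed auto
  ultimately show "\<exists>P. continuous_projection pointwise_topology P \<and> P ` topspace pointwise_topology = range synthesis" by blast
qed

text \<open>
  The range is the set of fixed points of a continuous projection. Closedness places the closed
  linear span of \<open>f\<close> inside the range, so that each of its elements is the sum of a series.
\<close>

lemma closedin_range_synthesis: "closedin pointwise_topology (range synthesis)"
proof -
  have proj: "continuous_map pointwise_topology (powertop_real UNIV) (synthesis \<circ> analysis)"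
    using continuous_map_compose[OF continuous_map_analysis continuous_map_synthesis]
    by (simp add: pointwise_topology_def continuous_map_in_subtopology)
  have "continuous_map pointwise_topology (powertop_real UNIV) (\<lambda>g. g)"
    by (simp add: continuous_map_componentwise_UNIV continuous_map_evaluation)
  moreover have "Hausdorff_space (powertop_real (UNIV :: 'a set))"
    by (simp add: Hausdorff_space_product_topology)
  ultimately have "closedin pointwise_topology {g \<in> topspace pointwise_topology. (synthesis \<circ> analysis) g = g}"
    using closedin_continuous_maps_eq proj by blast
  also have "{g \<in> topspace pointwise_topology. (synthesis \<circ> analysis) g = g} = range synthesis"
  proof
    show "{g \<in> topspace pointwise_topology. (synthesis \<circ> analysis) g = g} \<subseteq> range synthesis"
    proof
      fix g assume "g \<in> {g \<in> topspace pointwise_topology. (synthesis \<circ> analysis) g = g}"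
      then have "g = synthesis (analysis g)" by simp
      then show "g \<in> range synthesis" by (rule image_eqI[of _ synthesis "analysis g"]) simp
    qed
    show "range synthesis \<subseteq> {g \<in> topspace pointwise_topology. (synthesis \<circ> analysis) g = g}"
      using synthesis_in synthesis_analysis by (auto simp: topspace_pointwise_topology)
  qed
  finally show ?thesis .
qed

lemma partial_sum_apply: "(\<Sum>n<N. b n *\<^sub>R f n) v = (\<Sum>n<N. b n * f n v)"
  by (induction N) simp_all

lemma partial_sums_eventually_synthesis:
  "eventually (\<lambda>N. (\<Sum>n<N. b n *\<^sub>R f n) v = synthesis b v) sequentially"
proof -
  obtain k where k: "\<And>n. f n v \<noteq> 0 \<Longrightarrow> n < k"
    using finite_support[of v] finite_nat_set_iff_bounded by auto
  have "(\<Sum>n<N. b n *\<^sub>R f n) v = synthesis b v" if "N \<ge> k" for N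
    unfolding partial_sum_apply
    by (rule synthesis_eq_sum[symmetric]) (use k that in fastforce)+
  then show ?thesis using eventually_sequentially by blast
qed

lemma partial_sums_tendsto_iff:
  "(\<forall>v. ((\<lambda>N. (\<Sum>n<N. b n *\<^sub>R f n) v) \<longlongrightarrow> g v) sequentially) \<longleftrightarrow> g = synthesis b"
proof -
  have lim: "((\<lambda>N. (\<Sum>n<N. b n *\<^sub>R f n) v) \<longlongrightarrow> synthesis b v) sequentially" for v
    by (rule tendsto_eventually[OF partial_sums_eventually_synthesis])
  then show ?thesis by (auto intro: LIMSEQ_unique)
qed

text \<open>
  At each vector the partial sums are eventually constant, so convergence of the series with
  coefficients \<open>b\<close> to \<open>g\<close> just means \<open>g = synthesis b\<close>; since \<open>analysis\<close> inverts \<open>synthesis\<close>, the coefficients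
  of \<open>g\<close> are its values at the vectors \<open>y n\<close>.
\<close>

lemma basic_sequence_basis: "basic_sequence pointwise_topology f"
proof -
  define K where "K = pointwise_topology closure_of span (range f)"
  have span_sub: "span (range f) \<subseteq> range synthesis"
    by (rule span_minimal[OF _ subspace_range_synthesis]) (use basis_eq_synthesis in blast)
  then have span_D: "span (range f) \<subseteq> topspace pointwise_topology" using synthesis_in by (auto simp: topspace_pointwise_topology)
  have K_sub: "K \<subseteq> range synthesis"
    unfolding K_def by (rule closure_of_minimal[OF span_sub closedin_range_synthesis])
  have span_K: "span (range f) \<subseteq> K" unfolding K_def by (rule closure_of_subset[OF span_D])
  have K_X: "K \<subseteq> topspace pointwise_topology" unfolding K_def by (rule closure_of_subset_topspace)
  have top: "topspace (subtopology pointwise_topology K) = K" using K_X by auto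
  have partial_K: "(\<Sum>n<N. b n *\<^sub>R f n) \<in> K" for b N
    by (intro subsetD[OF span_K] span_sum span_scale span_base) auto
  have converges: "series_converges_to (subtopology pointwise_topology K) f b g \<longleftrightarrow> g = synthesis b" if g: "g \<in> K" for b g
  proof -
    have D: "(\<Sum>n<N. b n *\<^sub>R f n) \<in> D" "g \<in> D" for N
      using partial_K K_X g by (auto simp: topspace_pointwise_topology)
    have "series_converges_to (subtopology pointwise_topology K) f b g
        \<longleftrightarrow> (\<forall>v. ((\<lambda>N. (\<Sum>n<N. b n *\<^sub>R f n) v) \<longlongrightarrow> g v) sequentially)"
      unfolding series_converges_to_def limitin_subtopology pointwise_topology_def
      using g partial_K D by (simp add: limitin_componentwise)
    then show ?thesis using partial_sums_tendsto_iff by simp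
  qed
  have unique: "series_converges_to (subtopology pointwise_topology K) f b g \<longleftrightarrow> b = analysis g" if g: "g \<in> K" for b g
    unfolding converges[OF g] using analysis_synthesis synthesis_analysis K_sub g by (metis subsetD)
  have coeff: "schauder_coeff (subtopology pointwise_topology K) f n g = g (y n)" if "g \<in> K" for n g
    unfolding schauder_coeff_def unique[OF that] by (simp add: analysis_def)
  have "continuous_map (subtopology pointwise_topology K) euclideanreal (schauder_coeff (subtopology pointwise_topology K) f n)" for n
    by (rule continuous_map_eq[OF continuous_map_from_subtopology[OF continuous_map_evaluation[of "y n"]]])
       (use coeff top in auto)
  moreover have "range f \<subseteq> K" using span_K span_superset by blast
  ultimately have "Schauder_basis (subtopology pointwise_topology K) f"
    unfolding Schauder_basis_def top using unique by auto
  moreover have "range f \<subseteq> topspace pointwise_topology" using span_D span_superset by blast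
  ultimately show ?thesis by (simp add: basic_sequence_def K_def)
qed

end

section \<open>The weak-star dual of a strict inductive limit\<close>

theorem proposition24:
  fixes \<tau> :: "'a::real_vector topology"
  assumes "strict_LF_space \<tau>"
  shows "(\<exists>e. basic_sequence (weak_star \<tau>) e) \<and>
         contains_complemented_copy (weak_star \<tau>) (powertop_real (UNIV :: nat set))"
proof -
  obtain T where "LF_sequence T" "inductive_limit_topology T \<tau>"
    "\<And>n. subtopology (T (Suc n)) (topspace (T n)) = T n"
    using assms by (auto simp: strict_LF_space_def)
  then interpret strict_inductive_sequence T \<tau> by unfold_locales
  have "\<forall>n. \<exists>x. x \<in> topspace (T (Suc n)) - topspace (T n)"
    by (rule allI) (rule psubset_imp_ex_mem[OF step_psubset])
  from choice[OF this] obtain x where x: "\<And>n. x n \<in> topspace (T (Suc n)) - topspace (T n)"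
    by blast
  have "\<forall>n. \<exists>g. g \<in> continuous_dual \<tau> \<and> (\<forall>w\<in>topspace (T n). g w = 0) \<and> g (x n) = 1"
  proof
    fix n
    show "\<exists>g. g \<in> continuous_dual \<tau> \<and> (\<forall>w\<in>topspace (T n). g w = 0) \<and> g (x n) = 1"
      by (rule exists_dual_vanishing_on_step[OF x]) blast
  qed
  from choice[OF this] obtain f where f: "\<And>n. f n \<in> continuous_dual \<tau>"
    "\<And>n w. w \<in> topspace (T n) \<Longrightarrow> f n w = 0"
    "\<And>n. f n (x n) = 1"
    by blast
  have tri: "f n (x m) = 0" if "m < n" for m n
  proof -
    have "x m \<in> topspace (T n)" using subsetD[OF step_mono[of "Suc m" n]] x[of m] that by simp
    then show ?thesis by (rule f(2))
  qed
  have "linear (f n)" for n using f(1) by (simp add: continuous_dual_def)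
  then have "\<forall>m. \<exists>y. \<forall>n. f n y = (if n = m then 1 else 0)"
    using exists_biorthogonal_vector[of f x, OF _ f(3) tri] by simp
  from choice[OF this] obtain y where y: "\<And>m n. f n (y m) = (if n = m then 1 else 0)" by blast
  interpret biorthogonal_system "continuous_dual \<tau>" f y
    by unfold_locales (rule locally_finite_combination_in_dual[OF f(1,2)] y; assumption)+
  have "pointwise_topology = weak_star \<tau>" by (simp add: pointwise_topology_def weak_star_def)
  then show ?thesis
    using basic_sequence_basis contains_complemented_copy_power by auto
qed

end
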